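(* For real $s$, the series $$F(s)=\sum_{(a,b,c,d)} f(a,b,c,d)^s,$$ where the sum runs over all quadruples of non-negative integers $a,b,c,d$ with $ad-bc=1$, converges for $s>2/3$ and diverges for $s\le 2/3$.
   Context: Here $f(a,b,c,d)=\sqrt{a^2+b^2}+\sqrt{c^2+d^2}-\sqrt{(a+c)^2+(b+d)^2}$. This is positive for every quadruple occurring in the sum. *)

theory Defs
  imports "HOL-Analysis.Analysis"
begin

definition f :: "real \<Rightarrow> real \<Rightarrow> real \<Rightarrow> real \<Rightarrow> real" where
  "f a b c d = sqrt (a\<^sup>2 + b\<^sup>2) + sqrt (c\<^sup>2 + d\<^sup>2) - sqrt ((a + c)\<^sup>2 + (b + d)\<^sup>2)"

definition quadruples :: "(nat \<times> nat \<times> nat \<times> nat) set" where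
  "quadruples = {(a, b, c, d). int a * int d - int b * int c = 1}"

(* All bases are positive, so powr is the usual real power for every real exponent. *)
lemma f_pos:
  assumes "(a, b, c, d) \<in> quadruples"
  shows "f (real a) (real b) (real c) (real d) > 0"
proof -
  have "int a * int d - int b * int c = 1"
    using assms by (simp add: quadruples_def)
  then have "real_of_int (int a * int d - int b * int c) = 1"
    by simp
  then have det: "real a * real d - real b * real c = 1"
    by simp
  define x where "x = sqrt ((real a)\<^sup>2 + (real b)\<^sup>2)"
  define y where "y = sqrt ((real c)\<^sup>2 + (real d)\<^sup>2)"
  have x2: "x\<^sup>2 = (real a)\<^sup>2 + (real b)\<^sup>2" and y2: "y\<^sup>2 = (real c)\<^sup>2 + (real d)\<^sup>2"
    by (simp_all add: x_def y_def)
  have nonneg: "x \<ge> 0" "y \<ge> 0"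
    by (simp_all add: x_def y_def)
  have "(x * y)\<^sup>2 = (real a * real c + real b * real d)\<^sup>2 + (real a * real d - real b * real c)\<^sup>2"
    unfolding power_mult_distrib x2 y2 by (simp add: power2_eq_square algebra_simps)
  then have "(real a * real c + real b * real d)\<^sup>2 < (x * y)\<^sup>2"
    by (simp add: det)
  then have "real a * real c + real b * real d < x * y"
    using nonneg by (meson mult_nonneg_nonneg power2_less_imp_less)
  then have "(real a + real c)\<^sup>2 + (real b + real d)\<^sup>2 < (x + y)\<^sup>2"
    using x2 y2 by (simp add: power2_sum)
  then have "sqrt ((real a + real c)\<^sup>2 + (real b + real d)\<^sup>2) < x + y"
    using nonneg by (intro real_less_lsqrt) auto
  then show ?thesis
    by (simp add: f_def x_def y_def)
qed

end

theory Submission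
  imports Defs
begin

text \<open>
  Read a quadruple as a matrix with rows \<open>(a, b)\<close> and \<open>(c, d)\<close> of determinant one, and let
  \<open>x\<close>, \<open>y\<close>, \<open>z\<close> be the Euclidean lengths of the two rows and of their sum, and \<open>p\<close> the
  inner product of the rows. Rationalising twice, with \<open>(x y)^2 - p^2 = (a d - b c)^2 = 1\<close>, gives
  \<open>f = 2 (x y - p) / (x + y + z) = 2 / ((x y + p) (x + y + z))\<close>.
  Since \<open>0 \<le> p \<le> x y\<close> and \<open>0 \<le> z \<le> x + y\<close>, the value of \<open>f\<close> is \<open>1 / (x y (x + y))\<close> up to
  constant factors (\<open>f_det_one\<close>).

  For entries that are not negative, the lengths may be replaced by the row sums \<open>n = a + b\<close> and
  \<open>m = c + d\<close>, again up to constants (\<open>f_bounds\<close>). Bezout's identity says that the pair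
  \<open>(n, m)\<close> determines the matrix and runs exactly over the coprime pairs of positive integers
  (\<open>bij_row_sums\<close>). So the series behaves like the sum of \<open>(n m (n + m))^(-s)\<close> over
  coprime pairs.

  If \<open>s > 2/3\<close>, the inequality \<open>n + m \<ge> 2 sqrt (n m)\<close> bounds the terms by a multiple of
  \<open>n^(-3s/2) m^(-3s/2)\<close>, and the sum over all pairs is a square of a convergent series.

  As \<open>f \<le> 1\<close>, divergence is only at stake for \<open>s = 2/3\<close>, where the terms are at least a multiple of
  \<open>(n + m)^(-2)\<close>. That function is homogeneous of degree \<open>-2\<close>; splitting off the greatest common
  divisor turns its sum over all pairs into its sum over coprime pairs times the convergent series
  of the \<open>g^(-2)\<close>. The sum over all pairs contains a multiple of the harmonic series, so the sum
  over coprime pairs diverges (\<open>not_summable_coprime_pairs\<close>).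
\<close>

section \<open>Unimodular matrices and coprime row sums\<close>

definition row_sums :: "nat \<times> nat \<times> nat \<times> nat \<Rightarrow> nat \<times> nat" where
  "row_sums = (\<lambda>(a, b, c, d). (a + b, c + d))"

definition coprime_pairs :: "(nat \<times> nat) set" where
  "coprime_pairs = {(n, m). n > 0 \<and> m > 0 \<and> coprime n m}"

text \<open>
  Euclid's subtractive algorithm, run on the row sums: subtracting the smaller row sum from the larger
  one is undone on matrices by adding one row to the other, which keeps the determinant.
\<close>
lemma row_sums_surj:
  assumes "n > 0" "m > 0" "coprime n m"
  shows "\<exists>a b c d. (a, b, c, d) \<in> quadruples \<and> a + b = n \<and> c + d = m"
  using assms
proof (induction "n + m" arbitrary: n m rule: less_induct)
  case less
  consider "n = m" | "n < m" | "m < n" by linarith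
  then show ?case
  proof cases
    case 1
    then have "n = 1" "m = 1"
      using less.prems by auto
    then show ?thesis
      by (intro exI[of _ 1] exI[of _ 0] conjI) (auto simp: quadruples_def)
  next
    case 2
    have "coprime n (m - n)"
      using less.prems 2 gcd_diff1_nat[of n m] by (simp add: coprime_iff_gcd_eq_1 gcd.commute)
    then obtain a b c d where q: "(a, b, c, d) \<in> quadruples" "a + b = n" "c + d = m - n"
      using less.hyps[of n "m - n"] less.prems 2 by auto
    then have "(a, b, a + c, b + d) \<in> quadruples" "a + c + (b + d) = m"
      using 2 by (auto simp: quadruples_def algebra_simps)
    with q(2) show ?thesis by blast
  next
    case 3
    have "coprime (n - m) m"
      using less.prems 3 gcd_diff1_nat[of m n] by (simp add: coprime_iff_gcd_eq_1)
    then obtain a b c d where q: "(a, b, c, d) \<in> quadruples" "a + b = n - m" "c + d = m"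
      using less.hyps[of "n - m" m] less.prems 3 by auto
    then have "(a + c, b + d, c, d) \<in> quadruples" "a + c + (b + d) = n"
      using 3 by (auto simp: quadruples_def algebra_simps)
    with q(3) show ?thesis by blast
  qed
qed

text \<open>
  Adding the first column to the second keeps the determinant; this is the Bezout identity
  between the two row sums.
\<close>
lemma quadruples_row_sums:
  assumes "(a, b, c, d) \<in> quadruples"
  shows "int a * int (c + d) - int c * int (a + b) = 1"
  using assms by (simp add: quadruples_def algebra_simps)

lemma row_sums_coprime:
  assumes "(a, b, c, d) \<in> quadruples"
  shows "(a + b, c + d) \<in> coprime_pairs"
proof -
  have eq: "int a * int (c + d) - int c * int (a + b) = 1"
    using assms by (rule quadruples_row_sums)
  have "coprime (int (a + b)) (int (c + d))"
  proof (rule coprimeI)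
    fix g assume "g dvd int (a + b)" "g dvd int (c + d)"
    then have "g dvd int a * int (c + d) - int c * int (a + b)"
      by (intro dvd_diff dvd_mult)
    then show "is_unit g" by (simp only: eq)
  qed
  then have "coprime (a + b) (c + d)"
    by (simp only: coprime_int_iff)
  moreover have "a + b > 0" "c + d > 0"
    using assms by (auto simp: quadruples_def intro!: Nat.gr0I)
  ultimately show ?thesis by (simp add: coprime_pairs_def)
qed

text \<open>
  Two solutions of the Bezout identity for the same row sums have first entries that differ by a
  multiple of \<open>n = a + b\<close>. Both lie in \<open>{1..n}\<close>, so they agree, and with them everything else.
\<close>
lemma inj_row_sums: "inj_on row_sums quadruples"
proof (rule inj_onI)
  fix r r'
  assume r: "r \<in> quadruples" and r': "r' \<in> quadruples" and same: "row_sums r = row_sums r'"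
  obtain a b c d where r_eq: "r = (a, b, c, d)" by (cases r) auto
  obtain a' b' c' d' where r'_eq: "r' = (a', b', c', d')" by (cases r') auto
  have q: "(a, b, c, d) \<in> quadruples" and q': "(a', b', c', d') \<in> quadruples"
    using r r' by (simp_all add: r_eq r'_eq)
  have rows: "a' + b' = a + b" "c' + d' = c + d"
    using same by (simp_all add: row_sums_def r_eq r'_eq)
  define n where "n = int (a + b)"
  define m where "m = int (c + d)"
  have eq: "int a * m - int c * n = 1" and eq': "int a' * m - int c' * n = 1"
    using quadruples_row_sums[OF q] quadruples_row_sums[OF q'] rows by (simp_all add: n_def m_def)
  have cop: "coprime n m" and pos: "n > 0"
    using row_sums_coprime[OF q] by (simp_all add: coprime_pairs_def n_def m_def del: of_nat_add)
  have apos: "a > 0" "a' > 0"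
    using q q' by (auto simp: quadruples_def intro!: Nat.gr0I simp flip: of_nat_mult)
  have "(int a - int a') * m = (int c - int c') * n"
    using eq eq' by (simp add: algebra_simps)
  then have "n dvd int a - int a'"
    by (metis cop coprime_dvd_mult_left_iff dvd_triv_right)
  moreover have "\<bar>int a - int a'\<bar> < n"
    using apos rows by (auto simp: n_def abs_if)
  ultimately have aa: "a = a'"
    using dvd_imp_le_int[of "int a - int a'" n] pos by auto
  have "int c * n = int c' * n" using eq eq' unfolding aa by linarith
  then have "c = c'" using pos by (metis mult_right_cancel less_irrefl of_nat_eq_iff)
  then show "r = r'"
    using aa rows by (simp add: r_eq r'_eq)
qed

lemma bij_row_sums: "bij_betw row_sums quadruples coprime_pairs"
  unfolding bij_betw_def
proof (intro conjI inj_row_sums equalityI subsetI)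
  fix p assume "p \<in> row_sums ` quadruples"
  then show "p \<in> coprime_pairs"
    using row_sums_coprime by (auto simp: row_sums_def)
next
  fix p assume "p \<in> coprime_pairs"
  then obtain a b c d where "(a, b, c, d) \<in> quadruples" "row_sums (a, b, c, d) = p"
    using row_sums_surj[of "fst p" "snd p"] by (auto simp: coprime_pairs_def row_sums_def)
  then show "p \<in> row_sums ` quadruples"
    by (metis imageI)
qed

section \<open>The size of a term\<close>

text \<open>
  Both bounds come from the closed form \<open>f = 2 / ((x y + p) (x + y + z))\<close>, in which \<open>p\<close> ranges
  between \<open>0\<close> and \<open>x y\<close>, and \<open>z\<close> between \<open>0\<close> and \<open>x + y\<close>.
\<close>
lemma f_det_one:
  fixes a b c d :: real
  assumes nn: "a \<ge> 0" "b \<ge> 0" "c \<ge> 0" "d \<ge> 0" and det: "a * d - b * c = 1"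
  defines "x \<equiv> sqrt (a\<^sup>2 + b\<^sup>2)" and "y \<equiv> sqrt (c\<^sup>2 + d\<^sup>2)"
  shows "f a b c d \<le> 2 / (x * y * (x + y))" and "1 / (2 * x * y * (x + y)) \<le> f a b c d"
proof -
  define z where "z = sqrt ((a + c)\<^sup>2 + (b + d)\<^sup>2)"
  define p where "p = a * c + b * d"
  have x2: "x\<^sup>2 = a\<^sup>2 + b\<^sup>2" and y2: "y\<^sup>2 = c\<^sup>2 + d\<^sup>2" and z2: "z\<^sup>2 = (a + c)\<^sup>2 + (b + d)\<^sup>2"
    by (simp_all add: x_def y_def z_def)
  have "x \<noteq> 0" "y \<noteq> 0"
    using det by (auto simp: x_def y_def)
  then have pos: "x > 0" "y > 0" by (auto simp: x_def y_def less_le)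
  have z0: "z \<ge> 0" by (simp add: z_def)
  have p0: "p \<ge> 0" using nn by (simp add: p_def)
  have lagrange: "(x * y)\<^sup>2 - p\<^sup>2 = 1"
  proof -
    have "(x * y)\<^sup>2 - p\<^sup>2 = (a * d - b * c)\<^sup>2"
      unfolding power_mult_distrib x2 y2 p_def by (simp add: power2_eq_square algebra_simps)
    then show ?thesis by (simp add: det)
  qed
  have pxy: "p \<le> x * y"
  proof (rule power2_le_imp_le)
    show "p\<^sup>2 \<le> (x * y)\<^sup>2" using lagrange by linarith
    show "0 \<le> x * y" using pos by simp
  qed
  have zz: "z\<^sup>2 = (x + y)\<^sup>2 - 2 * (x * y - p)"
    unfolding power2_sum x2 y2 z2 p_def by (simp add: algebra_simps)
  have zxy: "z \<le> x + y"
  proof (rule power2_le_imp_le)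
    show "z\<^sup>2 \<le> (x + y)\<^sup>2" using pxy unfolding zz by simp
    show "0 \<le> x + y" using pos by simp
  qed
  have "f a b c d * ((x * y + p) * (x + y + z)) = ((x + y)\<^sup>2 - z\<^sup>2) * (x * y + p)"
    unfolding f_def x_def[symmetric] y_def[symmetric] z_def[symmetric]
    by (simp add: power2_eq_square algebra_simps)
  also have "\<dots> = 2 * ((x * y)\<^sup>2 - p\<^sup>2)"
    unfolding zz by (simp add: power2_eq_square algebra_simps)
  finally have "f a b c d * ((x * y + p) * (x + y + z)) = 2"
    by (simp add: lagrange)
  moreover have dpos: "(x * y + p) * (x + y + z) > 0"
    using pos p0 z0 by (simp add: add_pos_nonneg)
  ultimately have feq: "f a b c d = 2 / ((x * y + p) * (x + y + z))"
    by (metis less_irrefl nonzero_eq_divide_eq)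
  have "x * y * (x + y) \<le> (x * y + p) * (x + y + z)"
    using pos p0 z0 by (intro mult_mono) auto
  then show "f a b c d \<le> 2 / (x * y * (x + y))"
    unfolding feq using pos by (intro divide_left_mono) (auto simp: add_pos_pos dpos)
  have "(x * y + p) * (x + y + z) \<le> (2 * (x * y)) * (2 * (x + y))"
    using pos p0 z0 pxy zxy by (intro mult_mono) auto
  also have "\<dots> = 2 * (2 * x * y * (x + y))"
    by (simp only: mult_ac)
  finally have "2 / (2 * (2 * x * y * (x + y))) \<le> f a b c d"
    unfolding feq using pos dpos by (intro divide_left_mono) (auto simp: add_pos_pos)
  then show "1 / (2 * x * y * (x + y)) \<le> f a b c d"
    by (metis divide_divide_eq_left divide_self_if zero_neq_numeral)
qed

lemma euclidean_norm_bounds: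
  fixes a b :: real
  assumes "a \<ge> 0" "b \<ge> 0"
  shows "sqrt (a\<^sup>2 + b\<^sup>2) \<le> a + b" and "a + b \<le> 2 * sqrt (a\<^sup>2 + b\<^sup>2)"
proof -
  show "sqrt (a\<^sup>2 + b\<^sup>2) \<le> a + b"
    using assms by (rule sqrt_sum_squares_le_sum)
  have "a \<le> sqrt (a\<^sup>2 + b\<^sup>2)" "b \<le> sqrt (a\<^sup>2 + b\<^sup>2)"
    by simp_all
  then show "a + b \<le> 2 * sqrt (a\<^sup>2 + b\<^sup>2)" by linarith
qed

text \<open>
  The first bound separates the variables and serves convergence. The other two serve divergence:
  the second reduces smaller exponents to \<open>2/3\<close>, and the third becomes a homogeneous function of
  degree \<open>-2\<close> when raised to that power.
\<close>
lemma f_bounds: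
  assumes q: "(a, b, c, d) \<in> quadruples"
  defines "n \<equiv> real (a + b)" and "m \<equiv> real (c + d)"
  shows "f (real a) (real b) (real c) (real d) \<le> 8 * (n * m) powr (-3/2)"
    and "f (real a) (real b) (real c) (real d) \<le> 1"
    and "1 / (2 * (n + m) ^ 3) \<le> f (real a) (real b) (real c) (real d)"
proof -
  define x where "x = sqrt ((real a)\<^sup>2 + (real b)\<^sup>2)"
  define y where "y = sqrt ((real c)\<^sup>2 + (real d)\<^sup>2)"
  have "real_of_int (int a * int d - int b * int c) = 1"
    using q by (simp add: quadruples_def)
  then have det: "real a * real d - real b * real c = 1" by simp
  have upper: "f (real a) (real b) (real c) (real d) \<le> 2 / (x * y * (x + y))"
    and lower: "1 / (2 * x * y * (x + y)) \<le> f (real a) (real b) (real c) (real d)"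
    unfolding x_def y_def using f_det_one[OF _ _ _ _ det] by simp_all
  have nm: "n \<ge> 1" "m \<ge> 1"
    using row_sums_coprime[OF q] by (auto simp: coprime_pairs_def n_def m_def)
  have xn: "x \<le> n" "n \<le> 2 * x" and ym: "y \<le> m" "m \<le> 2 * y"
    using euclidean_norm_bounds by (simp_all add: x_def y_def n_def m_def)
  have "1 \<le> a\<^sup>2 + b\<^sup>2" "1 \<le> c\<^sup>2 + d\<^sup>2"
    using nm by (auto simp: n_def m_def Suc_le_eq)
  then have "1 \<le> (real a)\<^sup>2 + (real b)\<^sup>2" "1 \<le> (real c)\<^sup>2 + (real d)\<^sup>2"
    by (metis of_nat_1 of_nat_add of_nat_le_iff of_nat_power)+
  then have xy1: "x \<ge> 1" "y \<ge> 1" by (simp_all add: x_def y_def)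
  have "2 \<le> x * y * (x + y)"
    using mult_mono[of 1 "x * y" 2 "x + y"] mult_mono[of 1 x 1 y] xy1 by simp
  then have "2 / (x * y * (x + y)) \<le> 1" by simp
  with upper show "f (real a) (real b) (real c) (real d) \<le> 1" by linarith
  have "x * y * (x + y) \<le> (n + m) * (n + m) * (n + m)"
    using xn ym nm xy1 by (intro mult_mono) auto
  then have "1 / (2 * (n + m) ^ 3) \<le> 1 / (2 * x * y * (x + y))"
    using xy1 nm by (intro divide_left_mono) (simp_all add: power3_eq_cube mult.assoc)
  with lower show "1 / (2 * (n + m) ^ 3) \<le> f (real a) (real b) (real c) (real d)" by linarith
  have amgm: "sqrt (n * m) \<le> (n + m) / 2"
    using nm by (intro arith_geo_mean_sqrt) auto
  have "(n * m) powr (3/2) = (n * m) powr (1 + 1/2)" by simp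
  also have "\<dots> = n * m * sqrt (n * m)"
    using nm unfolding powr_add by (simp add: powr_half_sqrt)
  also have "\<dots> \<le> (2 * x) * (2 * y) * (x + y)"
    using xn ym nm xy1 amgm by (intro mult_mono) auto
  finally have le: "(n * m) powr (3/2) \<le> 4 * (x * y * (x + y))" by simp
  have "2 / (x * y * (x + y)) = 8 / (4 * (x * y * (x + y)))" by simp
  also have "\<dots> \<le> 8 / (n * m) powr (3/2)"
    using le nm xy1 by (intro divide_left_mono) auto
  also have "\<dots> = 8 * (n * m) powr (-3/2)"
    by (simp add: powr_minus_divide)
  finally show "f (real a) (real b) (real c) (real d) \<le> 8 * (n * m) powr (-3/2)"
    using upper by linarith
qed

section \<open>Convergence above the critical exponent\<close>

lemma summable_on_product_nonneg:
  fixes u :: "'a \<Rightarrow> real" and v :: "'b \<Rightarrow> real"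
  assumes u: "u summable_on A" and v: "v summable_on B"
    and nn: "\<And>x. x \<in> A \<Longrightarrow> u x \<ge> 0" "\<And>y. y \<in> B \<Longrightarrow> v y \<ge> 0"
  shows "(\<lambda>(x, y). u x * v y) summable_on (A \<times> B)"
proof (rule summable_on_SigmaI)
  show "((\<lambda>y. case (x, y) of (x, y) \<Rightarrow> u x * v y) has_sum u x * infsum v B) B" for x
    using v by (auto intro!: has_sum_cmult_right)
  show "(\<lambda>x. u x * infsum v B) summable_on A"
    using u by (rule summable_on_cmult_left)
qed (use nn in auto)

lemma summable_powr_f:
  fixes s :: real
  assumes s: "s > 2 / 3"
  shows "(\<lambda>(a, b, c, d). f (real a) (real b) (real c) (real d) powr s) summable_on quadruples"
proof -
  \<comment> \<open>Index zero is harmless: \<open>0 powr t = 0\<close>.\<close>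
  define t where "t = -3/2 * s"
  define u where "u = (\<lambda>n. real n powr t)"
  have "summable u"
    unfolding u_def summable_real_powr_iff using s by (simp add: t_def)
  then have "u summable_on UNIV"
    by (subst summable_on_UNIV_nonneg_real_iff) (auto simp: u_def)
  then have "(\<lambda>(n, m). u n * u m) summable_on (UNIV \<times> UNIV)"
    by (intro summable_on_product_nonneg) (auto simp: u_def)
  then have "(\<lambda>(n, m). u n * u m) summable_on coprime_pairs"
    by (rule summable_on_subset) auto
  then have "(\<lambda>q. case row_sums q of (n, m) \<Rightarrow> u n * u m) summable_on quadruples"
    by (subst summable_on_reindex_bij_betw[OF bij_row_sums])
  then have "(\<lambda>q. 8 powr s * (case row_sums q of (n, m) \<Rightarrow> u n * u m)) summable_on quadruples"
    by (rule summable_on_cmult_right)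
  then show ?thesis
  proof (rule summable_on_comparison_test, goal_cases)
    case (1 q)
    obtain a b c d where [simp]: "q = (a, b, c, d)" by (cases q) auto
    have q: "(a, b, c, d) \<in> quadruples" using 1 by simp
    have "f (real a) (real b) (real c) (real d) powr s
            \<le> (8 * (real (a + b) * real (c + d)) powr (-3/2)) powr s"
      using f_bounds(1)[OF q] f_pos[OF q] s by (intro powr_mono2) auto
    also have "\<dots> = 8 powr s * (u (a + b) * u (c + d))"
      by (simp add: powr_mult powr_powr u_def t_def)
    finally show ?case by (simp add: row_sums_def)
  qed auto
qed

section \<open>Divergence up to the critical exponent\<close>

text \<open>
  For fixed \<open>n\<close>, the \<open>n\<close> terms with \<open>m \<le> n\<close> are each at least \<open>1 / (2 n)^2\<close>, and so contribute at
  least \<open>1 / (4 n)\<close>.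
\<close>
lemma not_summable_all_pairs:
  "\<not> (\<lambda>(n, m). 1 / (real n + real m)\<^sup>2) summable_on {(n, m). n > 0 \<and> m > 0}"
proof
  assume "(\<lambda>(n, m). 1 / (real n + real m)\<^sup>2) summable_on {(n, m). n > 0 \<and> m > 0}"
  then have "(\<lambda>(n, m). 1 / (real n + real m)\<^sup>2) summable_on Sigma UNIV (\<lambda>n. {1..n})"
    by (rule summable_on_subset) auto
  then have "(\<lambda>n. \<Sum>\<^sub>\<infinity>m\<in>{1..n}. 1 / (real n + real m)\<^sup>2) summable_on UNIV"
    by (rule summable_on_Sigma_banach)
  then have "(\<lambda>n. inverse (real n) / 4) summable_on UNIV"
  proof (rule summable_on_comparison_test)
    fix n :: nat
    have "inverse (real n) / 4 = (\<Sum>m=1..n. 1 / (real n + real n)\<^sup>2)"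
      by (cases "n = 0") (auto simp: field_simps power2_eq_square)
    also have "\<dots> \<le> (\<Sum>m=1..n. 1 / (real n + real m)\<^sup>2)"
      by (intro sum_mono divide_left_mono power_mono mult_pos_pos zero_less_power) auto
    finally show "inverse (real n) / 4 \<le> (\<Sum>\<^sub>\<infinity>m\<in>{1..n}. 1 / (real n + real m)\<^sup>2)"
      by simp
  qed auto
  then have "summable (\<lambda>n. inverse (real n) / 4)"
    by (rule summable_on_imp_summable)
  then have "summable (\<lambda>n. inverse (real n))"
    by simp
  then show False
    using not_summable_harmonic by blast
qed

text \<open>
  Every pair of positive integers is uniquely \<open>(g n, g m)\<close> with \<open>n\<close> and \<open>m\<close> coprime, and its term is
  \<open>1 / g^2\<close> times the term of \<open>(n, m)\<close>. Convergence over coprime pairs would therefore spread to all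
  pairs.
\<close>
lemma not_summable_coprime_pairs:
  "\<not> (\<lambda>(n, m). 1 / (real n + real m)\<^sup>2) summable_on coprime_pairs"
proof
  assume cop: "(\<lambda>(n, m). 1 / (real n + real m)\<^sup>2) summable_on coprime_pairs"
  have "(\<lambda>g. 1 / (real g)\<^sup>2) summable_on {1..}"
    by (rule summable_on_subset[of _ UNIV])
       (auto simp: summable_on_UNIV_nonneg_real_iff inverse_eq_divide[symmetric]
             intro!: inverse_power_summable)
  from summable_on_product_nonneg[OF this cop]
  have "(\<lambda>(g, p). 1 / (real g)\<^sup>2 * (case p of (n, m) \<Rightarrow> 1 / (real n + real m)\<^sup>2))
          summable_on ({1..} \<times> coprime_pairs)"
    by auto
  also have "?this \<longleftrightarrow>
    (\<lambda>(n, m). 1 / (real n + real m)\<^sup>2) summable_on {(n, m). n > 0 \<and> m > 0}"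
  proof (rule summable_on_reindex_bij_witness[of _
          "\<lambda>(n, m). (gcd n m, n div gcd n m, m div gcd n m)" "\<lambda>(g, n, m). (g * n, g * m)"],
        goal_cases)
    case (1 x)
    then obtain g n m where [simp]: "x = (g, n, m)" and "g > 0" "gcd n m = 1"
      by (auto simp: coprime_pairs_def)
    then show ?case by (simp flip: gcd_mult_distrib_nat)
  next
    case (2 x)
    then show ?case by (auto simp: coprime_pairs_def)
  next
    case (3 p)
    then show ?case by auto
  next
    case (4 p)
    then show ?case
      by (auto simp: coprime_pairs_def div_gcd_coprime Suc_le_eq div_greater_zero_iff)
  next
    case (5 x)
    then show ?case
      by (auto simp: power_mult_distrib simp flip: distrib_left)
  qed
  finally show False
    using not_summable_all_pairs by blast
qed

lemma not_summable_powr_f: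
  fixes s :: real
  assumes s: "s \<le> 2 / 3"
  shows "\<not> (\<lambda>(a, b, c, d). f (real a) (real b) (real c) (real d) powr s) summable_on quadruples"
proof
  define C :: real where "C = (1/2) powr (2/3)"
  assume "(\<lambda>(a, b, c, d). f (real a) (real b) (real c) (real d) powr s) summable_on quadruples"
  then have "(\<lambda>q. C * (case row_sums q of (n, m) \<Rightarrow> 1 / (real n + real m)\<^sup>2)) summable_on quadruples"
  proof (rule summable_on_comparison_test, goal_cases)
    case (1 q)
    obtain a b c d where [simp]: "q = (a, b, c, d)" by (cases q) auto
    have q: "(a, b, c, d) \<in> quadruples" using 1 by simp
    define l where "l = real (a + b) + real (c + d)"
    have l: "l > 0"
      using row_sums_coprime[OF q] by (auto simp: l_def coprime_pairs_def simp del: of_nat_add add_gr_0)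
    have "(l ^ 3) powr (2/3) = l\<^sup>2"
      using l by (simp add: powr_powr flip: powr_numeral)
    then have "C * (1 / l\<^sup>2) = (1 / (2 * l ^ 3)) powr (2/3)"
      using l by (simp add: C_def powr_mult powr_divide)
    also have "\<dots> \<le> f (real a) (real b) (real c) (real d) powr (2/3)"
      using f_bounds(3)[OF q] l by (intro powr_mono2) (auto simp: l_def)
    also have "\<dots> \<le> f (real a) (real b) (real c) (real d) powr s"
      using f_bounds(2)[OF q] f_pos[OF q] s by (intro powr_mono') auto
    finally show ?case by (simp add: row_sums_def l_def)
  qed (auto simp: C_def split: prod.splits)
  then have "(\<lambda>q. case row_sums q of (n, m) \<Rightarrow> 1 / (real n + real m)\<^sup>2) summable_on quadruples"
    by (subst (asm) summable_on_cmult_right') (auto simp: C_def)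
  then show False
    using not_summable_coprime_pairs summable_on_reindex_bij_betw[OF bij_row_sums] by blast
qed

section \<open>The critical exponent\<close>

theorem mainTheorem1:
  fixes s :: real
  shows "(s > 2 / 3 \<longrightarrow>
            (\<lambda>(a, b, c, d). f (real a) (real b) (real c) (real d) powr s) summable_on quadruples) \<and>
         (s \<le> 2 / 3 \<longrightarrow>
            \<not> (\<lambda>(a, b, c, d). f (real a) (real b) (real c) (real d) powr s) summable_on quadruples)"
  using summable_powr_f not_summable_powr_f by blast

end
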